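(* For every $n\ge 1$ and every inert triplet $(H,G,\mathbf c)$ (with $H$ and $G$ on $n$ vertices), the value $\mathbf c(H')$ has the same residue modulo $4$ for every copy $H'$ of $H$ in $G$; that is, $\mathbf c(H')\equiv\mathbf c(H'')\pmod 4$ for any two copies $H',H''$ of $H$ in $G$.
   Context: For a $2$-edge-colouring $\mathbf c:E(G)\to\{-1,1\}$ of a graph $G$ and a subgraph $G'\subseteq G$, write $\mathbf c(G')=\sum_{e\in E(G')}\mathbf c(e)$. Let $G$ be a graph on $n$ vertices (a spanning subgraph of $K_n$). A colouring $\mathbf c:E(G)\to\{-1,1\}$ is called bipartite if there is a partition $(V_1,V_2)$ of the vertex set of $G$ such that either $\mathbf c^{-1}(1)$ or $\mathbf c^{-1}(-1)$ is equal to the edge set of $G[V_1]\cup G[V_2]$. For an $n$-vertex graph $H$, an $n$-vertex graph $G$ (a spanning subgraph of $K_n$) and a colouring $\mathbf c:E(G)\to\{-1,1\}$, the triplet $(H,G,\mathbf c)$ is inert if all degrees in $H$ have the same parity and the colouring $\mathbf c$ is bipartite. A copy of $H$ in $G$ is a subgraph of $G$ isomorphic to $H$. *)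

theory Defs
  imports "HOL-Number_Theory.Cong"
begin

record 'a ugraph =
  verts :: "'a set"
  edges :: "'a set set"

definition simple_graph :: "'a ugraph \<Rightarrow> bool" where
  "simple_graph G \<longleftrightarrow>
     finite (verts G) \<and> (\<forall>e\<in>edges G. e \<subseteq> verts G \<and> card e = 2)"

definition subgraph :: "'a ugraph \<Rightarrow> 'a ugraph \<Rightarrow> bool" where
  "subgraph G' G \<longleftrightarrow>
     simple_graph G' \<and> simple_graph G \<and> verts G' \<subseteq> verts G \<and> edges G' \<subseteq> edges G"

definition graph_iso :: "'a ugraph \<Rightarrow> 'b ugraph \<Rightarrow> bool" where
  "graph_iso G H \<longleftrightarrow>
     (\<exists>f. bij_betw f (verts G) (verts H) \<and>
          (\<forall>u\<in>verts G. \<forall>v\<in>verts G. {u, v} \<in> edges G \<longleftrightarrow> {f u, f v} \<in> edges H))"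

definition copy_in :: "'b ugraph \<Rightarrow> 'a ugraph \<Rightarrow> 'a ugraph \<Rightarrow> bool" where
  "copy_in H G H' \<longleftrightarrow> subgraph H' G \<and> graph_iso H H'"

definition degree :: "'a ugraph \<Rightarrow> 'a \<Rightarrow> nat" where
  "degree G v = card {e \<in> edges G. v \<in> e}"

definition induced :: "'a ugraph \<Rightarrow> 'a set \<Rightarrow> 'a ugraph" where
  "induced G W = \<lparr>verts = verts G \<inter> W, edges = {e \<in> edges G. e \<subseteq> W}\<rparr>"

definition graph_union :: "'a ugraph \<Rightarrow> 'a ugraph \<Rightarrow> 'a ugraph" where
  "graph_union G H = \<lparr>verts = verts G \<union> verts H, edges = edges G \<union> edges H\<rparr>"

(* A colouring of E(G) is a total function on sets; only its values on edges G matter. *)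
definition two_edge_colouring :: "'a ugraph \<Rightarrow> ('a set \<Rightarrow> int) \<Rightarrow> bool" where
  "two_edge_colouring G c \<longleftrightarrow> (\<forall>e\<in>edges G. c e \<in> {-1, 1})"

definition colour_sum :: "('a set \<Rightarrow> int) \<Rightarrow> 'a ugraph \<Rightarrow> int" where
  "colour_sum c G = (\<Sum>e\<in>edges G. c e)"

definition colour_class :: "'a ugraph \<Rightarrow> ('a set \<Rightarrow> int) \<Rightarrow> int \<Rightarrow> 'a set set" where
  "colour_class G c i = {e \<in> edges G. c e = i}"

(* One of the two parts may be empty, so constant colourings are bipartite. *)
definition bipartite_colouring :: "'a ugraph \<Rightarrow> ('a set \<Rightarrow> int) \<Rightarrow> bool" where
  "bipartite_colouring G c \<longleftrightarrow>
     (\<exists>V1 V2. V1 \<union> V2 = verts G \<and> V1 \<inter> V2 = {} \<and>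
        (colour_class G c 1 = edges (graph_union (induced G V1) (induced G V2)) \<or>
         colour_class G c (-1) = edges (graph_union (induced G V1) (induced G V2))))"

definition inert :: "'b ugraph \<Rightarrow> 'a ugraph \<Rightarrow> ('a set \<Rightarrow> int) \<Rightarrow> bool" where
  "inert H G c \<longleftrightarrow>
     (\<forall>u\<in>verts H. \<forall>v\<in>verts H. even (degree H u) \<longleftrightarrow> even (degree H v)) \<and>
     bipartite_colouring G c"

end

theory Submission
  imports Defs
begin

text \<open>
  Let \<open>V\<^sub>1, V\<^sub>2\<close> be the parts of the bipartite colouring. If \<open>k\<close> edges of a copy \<open>H'\<close> cross between
  the parts, then \<open>c(H') = \<plusminus>(|E(H)| - 2k)\<close> with a sign depending only on the colouring. Summing the
  degrees in \<open>H'\<close> over \<open>V\<^sub>1\<close> counts each crossing edge once and every other edge an even number of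
  times, so \<open>k\<close> is congruent to this degree sum modulo 2. Since \<open>H'\<close> spans \<open>G\<close> and all degrees have
  the same parity, the parity of the degree sum depends only on \<open>|V\<^sub>1|\<close> and on that parity.
\<close>

lemma simple_graphD:
  assumes "simple_graph G"
  shows "finite (verts G)" "finite (edges G)"
    and "e \<in> edges G \<Longrightarrow> e \<subseteq> verts G" "e \<in> edges G \<Longrightarrow> card e = 2"
proof -
  show fin: "finite (verts G)"
    using assms by (simp add: simple_graph_def)
  show sub: "e \<subseteq> verts G" if "e \<in> edges G" for e
    using assms that by (simp add: simple_graph_def)
  show "card e = 2" if "e \<in> edges G"
    using assms that by (simp add: simple_graph_def)
  show "finite (edges G)"
    by (rule finite_subset[of _ "Pow (verts G)"]) (use fin sub in auto)
qed

text \<open>\<open>graph_iso\<close> speaks only about pairs of vertices. Since every edge is a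
  two-element set of vertices, preserving adjacency already makes taking images under
  \<open>f\<close> a bijection between the edge sets, which lets cardinalities be
  transferred.\<close>

lemma graph_iso_edges:
  assumes "simple_graph G" "simple_graph H"
    and "bij_betw f (verts G) (verts H)"
    and adj: "\<forall>u\<in>verts G. \<forall>v\<in>verts G. {u, v} \<in> edges G \<longleftrightarrow> {f u, f v} \<in> edges H"
  shows "edges H = (`) f ` edges G" "inj_on ((`) f) (edges G)"
proof -
  have inj: "inj_on f (verts G)" and surj: "f ` verts G = verts H"
    using assms(3) by (auto simp: bij_betw_def)
  have sub: "edges G \<subseteq> Pow (verts G)"
    using simple_graphD[OF assms(1)] by blast
  show "inj_on ((`) f) (edges G)"
    using inj_on_image_Pow[OF inj] sub inj_on_subset by blast
  show "edges H = (`) f ` edges G"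
  proof (intro equalityI subsetI)
    fix e assume e: "e \<in> edges H"
    then obtain x y where xy: "e = {x, y}"
      using simple_graphD(4)[OF assms(2)] card_2_iff by metis
    moreover have "x \<in> verts H" "y \<in> verts H"
      using simple_graphD(3)[OF assms(2) e] xy by auto
    ultimately obtain u v where uv: "u \<in> verts G" "v \<in> verts G" "x = f u" "y = f v"
      using surj by (metis imageE)
    then have "{u, v} \<in> edges G" "e = f ` {u, v}"
      using adj e xy by simp_all
    then show "e \<in> (`) f ` edges G" by blast
  next
    fix e' assume "e' \<in> (`) f ` edges G"
    then obtain e where e: "e \<in> edges G" "e' = f ` e" by blast
    then obtain u v where "e = {u, v}"
      using simple_graphD(4)[OF assms(1)] card_2_iff by metis
    then show "e' \<in> edges H"
      using adj simple_graphD(3)[OF assms(1)] e by auto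
  qed
qed

lemma graph_iso_card_edges:
  assumes "simple_graph G" "simple_graph H" "graph_iso G H"
  shows "card (edges H) = card (edges G)"
proof -
  obtain f where f: "bij_betw f (verts G) (verts H)"
    "\<forall>u\<in>verts G. \<forall>v\<in>verts G. {u, v} \<in> edges G \<longleftrightarrow> {f u, f v} \<in> edges H"
    using assms(3) unfolding graph_iso_def by blast
  show ?thesis
    using graph_iso_edges[OF assms(1,2) f] by (simp add: card_image)
qed

lemma graph_iso_degree:
  assumes "simple_graph G" "simple_graph H"
    and bij: "bij_betw f (verts G) (verts H)"
    and adj: "\<forall>u\<in>verts G. \<forall>v\<in>verts G. {u, v} \<in> edges G \<longleftrightarrow> {f u, f v} \<in> edges H"
    and "v \<in> verts G"
  shows "degree H (f v) = degree G v"
proof -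
  note iso = graph_iso_edges[OF assms(1-4)]
  have "f v \<in> f ` e \<longleftrightarrow> v \<in> e" if "e \<in> edges G" for e
    using bij_betw_imp_inj_on[OF bij] \<open>v \<in> verts G\<close> simple_graphD(3)[OF assms(1) that]
    by (simp add: inj_on_image_mem_iff)
  then have "{e \<in> edges H. f v \<in> e} = (`) f ` {e \<in> edges G. v \<in> e}"
    unfolding iso(1) by auto
  moreover have "inj_on ((`) f) {e \<in> edges G. v \<in> e}"
    using iso(2) by (rule inj_on_subset) auto
  ultimately show ?thesis
    unfolding degree_def by (simp add: card_image)
qed

text \<open>Double counting of the incident pairs of a vertex in \<open>W\<close> and an
  edge.\<close>

lemma sum_degree:
  assumes "simple_graph G" "finite W"
  shows "(\<Sum>v\<in>W. degree G v) = (\<Sum>e\<in>edges G. card (e \<inter> W))"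
proof -
  have "(\<Sum>v\<in>W. degree G v) = (\<Sum>v\<in>W. \<Sum>e | e \<in> edges G \<and> v \<in> e. 1)"
    by (simp add: degree_def)
  also have "\<dots> = (\<Sum>e\<in>edges G. \<Sum>v | v \<in> W \<and> v \<in> e. 1)"
    using assms(2) simple_graphD(2)[OF assms(1)] by (rule sum.swap_restrict)
  also have "\<dots> = (\<Sum>e\<in>edges G. card {v \<in> W. v \<in> e})"
    by simp
  also have "\<dots> = (\<Sum>e\<in>edges G. card (e \<inter> W))"
    by (intro sum.cong refl arg_cong[of _ _ card]) blast
  finally show ?thesis .
qed

text \<open>A sum of naturals has the parity of its number of odd terms; this is applied to both
  sides of the double count.\<close>

lemma even_card_crossing_edges:
  assumes "simple_graph G" "finite W"
  shows "even (card {e \<in> edges G. odd (card (e \<inter> W))}) \<longleftrightarrow> even (card {v \<in> W. odd (degree G v)})"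
  using sum_degree[OF assms] even_sum_iff[OF assms(2), of "degree G"]
    even_sum_iff[OF simple_graphD(2)[OF assms(1)], of "\<lambda>e. card (e \<inter> W)"]
  by simp

text \<open>An edge has zero, one or two ends in \<open>V1\<close>, and it crosses exactly when it
  has one. Crossing thus becomes a parity condition on a single part.\<close>

lemma odd_card_Int_iff:
  assumes "card e = 2" "e \<subseteq> V1 \<union> V2" "V1 \<inter> V2 = {}"
  shows "odd (card (e \<inter> V1)) \<longleftrightarrow> \<not> (e \<subseteq> V1 \<or> e \<subseteq> V2)"
proof -
  obtain x y where "e = {x, y}" "x \<noteq> y"
    using assms(1) card_2_iff by metis
  then show ?thesis
    using assms(2,3) by (cases "x \<in> V1"; cases "y \<in> V1") auto
qed

text \<open>Here \<open>V\<close> is one of the two parts and \<open>s\<close> is the colour of the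
  edges inside a part, so both alternatives of the definition are covered at once.\<close>

lemma bipartite_colouringE:
  assumes "simple_graph G" "two_edge_colouring G c" "bipartite_colouring G c"
  obtains V s where "V \<subseteq> verts G"
    "\<And>e. e \<in> edges G \<Longrightarrow> c e = (if odd (card (e \<inter> V)) then - s else s)"
proof -
  obtain V1 V2 where V: "V1 \<union> V2 = verts G" "V1 \<inter> V2 = {}"
    and colour: "colour_class G c 1 = edges (graph_union (induced G V1) (induced G V2)) \<or>
      colour_class G c (-1) = edges (graph_union (induced G V1) (induced G V2))"
    using assms(3) unfolding bipartite_colouring_def by blast
  have mono: "edges (graph_union (induced G V1) (induced G V2)) =
      {e \<in> edges G. even (card (e \<inter> V1))}"
    using odd_card_Int_iff[OF _ _ V(2)] simple_graphD(3,4)[OF assms(1)] V(1)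
    by (auto simp: graph_union_def induced_def)
  obtain s :: int where s: "s = 1 \<or> s = -1"
    and "colour_class G c s = {e \<in> edges G. even (card (e \<inter> V1))}"
    using colour mono by metis
  then have "c e = s \<longleftrightarrow> even (card (e \<inter> V1))" if "e \<in> edges G" for e
    using that unfolding colour_class_def by blast
  \<comment> \<open>With only the colours 1 and -1, an edge not coloured \<open>s\<close> is
    coloured \<open>- s\<close>.\<close>
  then have "c e = (if odd (card (e \<inter> V1)) then - s else s)" if "e \<in> edges G" for e
    using that assms(2) s unfolding two_edge_colouring_def by fastforce
  then show ?thesis
    using that V(1) by blast
qed

text \<open>Compared with the constant value \<open>s\<close>, each element satisfying
  \<open>P\<close> lowers the sum by \<open>2 * s\<close>.\<close>

lemma sum_signed:
  fixes s :: int
  assumes "finite E" "\<And>e. e \<in> E \<Longrightarrow> c e = (if P e then - s else s)"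
  shows "sum c E = s * (int (card E) - 2 * int (card {e \<in> E. P e}))"
proof -
  have "sum c E = (\<Sum>e\<in>E. s - (if P e then 2 * s else 0))"
    using assms(2) by (intro sum.cong) auto
  also have "\<dots> = s * int (card E) - (\<Sum>e | e \<in> E \<and> P e. 2 * s)"
    using assms(1) by (simp add: sum_subtractf flip: sum.inter_filter)
  finally show ?thesis
    by (simp add: algebra_simps)
qed

lemma copy_inE:
  assumes "simple_graph H" "simple_graph G" "card (verts H) = card (verts G)" "copy_in H G H'"
    and parity: "\<forall>v\<in>verts H. odd (degree H v) \<longleftrightarrow> p"
  shows "simple_graph H'" "edges H' \<subseteq> edges G" "card (edges H') = card (edges H)"
    and "\<forall>v\<in>verts G. odd (degree H' v) \<longleftrightarrow> p"
proof -
  show H': "simple_graph H'" and "edges H' \<subseteq> edges G"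
    using assms(4) by (auto simp: copy_in_def subgraph_def)
  show "card (edges H') = card (edges H)"
    using assms(4) graph_iso_card_edges[OF assms(1) H'] by (simp add: copy_in_def)
  obtain f where f: "bij_betw f (verts H) (verts H')"
    "\<forall>u\<in>verts H. \<forall>v\<in>verts H. {u, v} \<in> edges H \<longleftrightarrow> {f u, f v} \<in> edges H'"
    using assms(4) unfolding copy_in_def graph_iso_def by blast
  have "verts H' \<subseteq> verts G"
    using assms(4) by (simp add: copy_in_def subgraph_def)
  \<comment> \<open>A subset of a finite set with the same cardinality is the whole set, so the copy
    is spanning and the degree parity is known at every vertex of \<open>G\<close>.\<close>
  then have "verts H' = verts G"
    using bij_betw_same_card[OF f(1)] assms(3) simple_graphD(1)[OF assms(2)]
    by (simp add: card_subset_eq)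
  then have "verts G = f ` verts H"
    using bij_betw_imp_surj_on[OF f(1)] by simp
  then show "\<forall>v\<in>verts G. odd (degree H' v) \<longleftrightarrow> p"
    using parity graph_iso_degree[OF assms(1) H' f] by simp
qed

theorem proposition1p14:
  fixes n :: nat
    and H :: "'b ugraph"
    and G :: "'a ugraph"
    and c :: "'a set \<Rightarrow> int"
    and H' H'' :: "'a ugraph"
  assumes "n \<ge> 1"
    and "simple_graph H" and "card (verts H) = n"
    and "simple_graph G" and "card (verts G) = n"
    and "two_edge_colouring G c"
    and "inert H G c"
    and "copy_in H G H'" and "copy_in H G H''"
  shows "[colour_sum c H' = colour_sum c H''] (mod 4)"
proof -
  obtain p where p: "\<forall>v\<in>verts H. odd (degree H v) \<longleftrightarrow> p"
    using assms(7) unfolding inert_def by metis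
  obtain V s where V: "V \<subseteq> verts G"
    and c: "\<And>e. e \<in> edges G \<Longrightarrow> c e = (if odd (card (e \<inter> V)) then - s else s)"
    using bipartite_colouringE[OF assms(4,6)] assms(7) unfolding inert_def by blast
  have "finite V"
    using V simple_graphD(1)[OF assms(4)] finite_subset by blast
  define k where "k K = card {e \<in> edges K. odd (card (e \<inter> V))}" for K :: "'a ugraph"
  \<comment> \<open>The set \<open>{v \<in> V. p}\<close> is \<open>V\<close> or empty and does not
    mention \<open>K\<close>, so the parity of \<open>k K\<close> is the same for all
    copies.\<close>
  have copy: "colour_sum c K = s * (int (card (edges H)) - 2 * int (k K))"
    "even (k K) \<longleftrightarrow> even (card {v \<in> V. p})"
    if "copy_in H G K" for K
  proof -
    have card_eq: "card (verts H) = card (verts G)"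
      using assms(3,5) by simp
    note K = copy_inE[OF assms(2,4) card_eq that p]
    show "colour_sum c K = s * (int (card (edges H)) - 2 * int (k K))"
      unfolding colour_sum_def k_def K(3)[symmetric]
      using simple_graphD(2)[OF K(1)] c K(2) by (intro sum_signed) auto
    have "{v \<in> V. odd (degree K v)} = {v \<in> V. p}"
      using K(4) V by auto
    then show "even (k K) \<longleftrightarrow> even (card {v \<in> V. p})"
      unfolding k_def even_card_crossing_edges[OF K(1) \<open>finite V\<close>] by simp
  qed
  have "even (int (k H'') - int (k H'))"
    using copy(2)[OF assms(8)] copy(2)[OF assms(9)] by simp
  then obtain m where "int (k H'') - int (k H') = 2 * m" ..
  then have "int (k H'') = int (k H') + 2 * m"
    by simp
  \<comment> \<open>The edge count cancels; one factor 2 comes from the colour sum, the other from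
    the even difference of the crossing numbers.\<close>
  then have "colour_sum c H' - colour_sum c H'' = 4 * (s * m)"
    unfolding copy(1)[OF assms(8)] copy(1)[OF assms(9)] by (simp add: algebra_simps)
  then show ?thesis
    unfolding cong_iff_dvd_diff by simp
qed

end
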